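(* Let $K$ be an integer and $p$ an odd prime. Then $\omega_K(p)=4$ if and only if $\alpha_K(p)\equiv\pm1\pmod4$; $\omega_K(p)=2$ if and only if $\alpha_K(p)\equiv0\pmod4$; and $\omega_K(p)=1$ if and only if $\alpha_K(p)\equiv2\pmod 4$.
   Context: For an integer $K$, the $K$-Fibonacci sequence is $F_{K,0}=0$, $F_{K,1}=1$, $F_{K,n}=KF_{K,n-1}+F_{K,n-2}$ for $n\ge2$. For an integer $m\ge 2$, $\pi_K(m)$ is the least positive period of $(F_{K,n}\bmod m)$, $\alpha_K(m)$ is the least positive index $n$ with $m\mid F_{K,n}$, and $\omega_K(m)$ is the number of indices $0\le n<\pi_K(m)$ with $m\mid F_{K,n}$. *)

theory Defs
  imports "HOL-Number_Theory.Number_Theory"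
begin

fun kfib :: "int \<Rightarrow> nat \<Rightarrow> int" where
  "kfib K 0 = 0"
| "kfib K (Suc 0) = 1"
| "kfib K (Suc (Suc n)) = K * kfib K (Suc n) + kfib K n"

text \<open>
  The recurrence is invertible modulo any \<open>m\<close>, so the reduced sequence is purely periodic from
  index 0; hence the period condition is imposed for all \<open>n\<close>. The two minima below exist for all
  \<open>m > 0\<close>.
\<close>

definition kfib_period :: "int \<Rightarrow> nat \<Rightarrow> nat" where
  "kfib_period K m =
     (LEAST t. t > 0 \<and> (\<forall>n. [kfib K (n + t) = kfib K n] (mod int m)))"

definition kfib_rank :: "int \<Rightarrow> nat \<Rightarrow> nat" where
  "kfib_rank K m = (LEAST n. n > 0 \<and> int m dvd kfib K n)"

definition kfib_zeros :: "int \<Rightarrow> nat \<Rightarrow> nat" where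
  "kfib_zeros K m = card {n. n < kfib_period K m \<and> int m dvd kfib K n}"

end

theory Submission
  imports Defs
begin

text \<open>
  Let \<open>a\<close> be the rank and \<open>s = F (a + 1)\<close>. Modulo \<open>p\<close>, shifting the index by \<open>a\<close> multiplies the
  sequence by \<open>s\<close>, so the period is \<open>a\<close> times the multiplicative order of \<open>s\<close>, and this order is
  the number of zeros. Cassini's identity gives \<open>s\<^sup>2 = (-1) ^ a\<close>, so the order is \<open>4\<close> if \<open>a\<close> is odd.
  If \<open>a = 2 * b\<close>, then \<open>F (2 * b) = F b * (2 * F (b + 1) - K * F b)\<close> with \<open>p\<close> not dividing \<open>F b\<close>,
  and Cassini's identity at \<open>b\<close> yields \<open>s = - ((-1) ^ b)\<close>.
\<close>

section \<open>Integer identities for the sequence\<close>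

lemma kfib_add:
  "kfib K (Suc (n + a)) = kfib K (Suc n) * kfib K (Suc a) + kfib K n * kfib K a"
proof (induction K n rule: kfib.induct)
  case (3 K n)
  have "kfib K (Suc (Suc (Suc n) + a)) = K * kfib K (Suc (Suc n + a)) + kfib K (Suc (n + a))"
    by simp
  also have "\<dots> = K * (kfib K (Suc (Suc n)) * kfib K (Suc a) + kfib K (Suc n) * kfib K a)
      + (kfib K (Suc n) * kfib K (Suc a) + kfib K n * kfib K a)"
    by (simp only: "3.IH")
  finally show ?case by (simp add: algebra_simps)
qed simp_all

text \<open>The left side is a 2x2 determinant in \<open>i\<close>; one step of the recurrence only
  flips its sign. The case \<open>d = 1\<close> is Cassini's identity, while general
  \<open>d\<close> turns a repetition modulo \<open>m\<close> into a zero.\<close>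

lemma kfib_dOcagne:
  "kfib K (i + d) * kfib K (Suc i) - kfib K (Suc (i + d)) * kfib K i = (-1) ^ i * kfib K d"
proof (induction i)
  case (Suc i)
  have "kfib K (Suc i + d) * kfib K (Suc (Suc i)) - kfib K (Suc (Suc i + d)) * kfib K (Suc i)
      = - (kfib K (i + d) * kfib K (Suc i) - kfib K (Suc (i + d)) * kfib K i)"
    by (simp add: algebra_simps)
  also have "\<dots> = (-1) ^ Suc i * kfib K d"
    by (simp only: Suc.IH) simp
  finally show ?case .
qed simp

lemma kfib_cassini:
  "kfib K (Suc n) ^ 2 - K * kfib K (Suc n) * kfib K n - kfib K n ^ 2 = (-1) ^ n"
  using kfib_dOcagne[of K n 1] by (simp add: algebra_simps power2_eq_square)

text \<open>The second factor is the Lucas-type number \<open>F (n + 1) + F (n - 1)\<close>, with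
  \<open>F (n - 1)\<close> eliminated so that the formula also makes sense at
  \<open>n = 0\<close>.\<close>

lemma kfib_double: "kfib K (2 * n) = kfib K n * (2 * kfib K (Suc n) - K * kfib K n)"
proof (cases n)
  case (Suc m)
  then have "kfib K (2 * n) = kfib K n * (kfib K (Suc n) + kfib K m)"
    using kfib_add[of K m n] by (simp only: mult_2 add_Suc distrib_left mult.commute[of "kfib K m"])
  also have "kfib K (Suc n) + kfib K m = 2 * kfib K (Suc n) - K * kfib K n"
    using Suc by simp
  finally show ?thesis .
qed simp

lemma kfib_double_Suc: "kfib K (Suc (2 * n)) = kfib K (Suc n) ^ 2 + kfib K n ^ 2"
  using kfib_add[of K n n] by (simp add: mult_2 power2_eq_square)

section \<open>Zeros modulo m and the rank\<close>

text \<open>Pigeonhole: some pair of consecutive residues recurs after \<open>d\<close> steps, and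
  d'Ocagne's identity then puts a zero at index \<open>d\<close>, without running the recurrence
  backwards.\<close>

lemma kfib_zero_exists:
  assumes "m > 0"
  shows "\<exists>n>0. int m dvd kfib K n"
proof -
  define g where "g n = (kfib K n mod int m, kfib K (Suc n) mod int m)" for n
  have "range g \<subseteq> {0..<int m} \<times> {0..<int m}"
    using assms by (auto simp: g_def)
  then have "finite (range g)"
    by (rule finite_subset) simp
  then have "\<not> inj g"
    using finite_imageD[of g UNIV] by auto
  then obtain i j where "i < j" "g i = g j"
    unfolding inj_def by (metis linorder_neqE_nat)
  then obtain d where d: "d > 0" "g (i + d) = g i"
    by (metis less_imp_add_positive)
  \<comment> \<open>Replacing both shifted residues by the unshifted ones makes the determinant
    cancel to zero.\<close>
  then have "[kfib K (i + d) * kfib K (Suc i) - kfib K (Suc (i + d)) * kfib K i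
      = kfib K i * kfib K (Suc i) - kfib K (Suc i) * kfib K i] (mod int m)"
    by (intro cong_diff cong_mult) (simp_all add: g_def cong_def)
  then have "int m dvd (-1) ^ i * kfib K d"
    by (simp add: kfib_dOcagne cong_0_iff)
  then have "int m dvd kfib K d"
    by (cases "even i") auto
  with d show ?thesis by blast
qed

lemma kfib_rank:
  assumes "m > 0"
  shows kfib_rank_pos: "kfib_rank K m > 0"
    and dvd_kfib_rank: "int m dvd kfib K (kfib_rank K m)"
proof -
  have "kfib_rank K m > 0 \<and> int m dvd kfib K (kfib_rank K m)"
    unfolding kfib_rank_def using kfib_zero_exists[OF assms] by (rule LeastI_ex)
  then show "kfib_rank K m > 0" "int m dvd kfib K (kfib_rank K m)" by auto
qed

lemma not_dvd_kfib_less_rank: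
  assumes "0 < n" "n < kfib_rank K m"
  shows "\<not> int m dvd kfib K n"
  using assms not_less_Least[of n "\<lambda>n. n > 0 \<and> int m dvd kfib K n"]
  unfolding kfib_rank_def by blast

lemma kfib_add_cong:
  assumes "m dvd kfib K a"
  shows "[kfib K (n + a) = kfib K (Suc a) * kfib K n] (mod m)"
proof (cases n)
  case 0
  then show ?thesis using assms by (simp add: cong_0_iff)
next
  case (Suc k)
  have "[kfib K k * kfib K a = 0] (mod m)"
    using assms by (simp add: cong_0_iff)
  from cong_add[OF cong_refl this] show ?thesis
    using Suc kfib_add[of K k a] by (simp add: mult.commute)
qed

lemma kfib_add_mult_cong:
  assumes "m dvd kfib K a"
  shows "[kfib K (n + q * a) = kfib K (Suc a) ^ q * kfib K n] (mod m)"
proof (induction q)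
  case (Suc q)
  have "[kfib K (n + q * a + a) = kfib K (Suc a) * kfib K (n + q * a)] (mod m)"
    using assms by (rule kfib_add_cong)
  also have "[kfib K (Suc a) * kfib K (n + q * a)
      = kfib K (Suc a) * (kfib K (Suc a) ^ q * kfib K n)] (mod m)"
    using Suc.IH by (rule cong_scalar_left)
  finally show ?case by (simp add: algebra_simps)
qed simp

lemma kfib_Suc_square_cong:
  assumes "m dvd kfib K a"
  shows "[kfib K (Suc a) ^ 2 = (-1) ^ a] (mod m)"
proof -
  have "kfib K (Suc a) ^ 2 - (-1) ^ a = kfib K a * (K * kfib K (Suc a) + kfib K a)"
    using kfib_cassini[of K a] by (simp add: algebra_simps power2_eq_square)
  then show ?thesis
    using assms by (simp add: cong_iff_dvd_diff)
qed

text \<open>The square is congruent to a power of \<open>-1\<close>, hence a unit modulo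
  \<open>m\<close>.\<close>

lemma coprime_kfib_Suc:
  assumes "m dvd kfib K a"
  shows "coprime (kfib K (Suc a)) m"
proof -
  have "coprime (kfib K (Suc a) ^ 2) m"
    using cong_imp_coprime[OF cong_sym[OF kfib_Suc_square_cong[OF assms]]]
    by simp
  then show ?thesis by simp
qed

text \<open>Reducing \<open>n\<close> modulo the rank changes the term only by a unit factor, and a
  nonzero remainder below the rank gives no zero.\<close>

lemma dvd_kfib_iff:
  assumes "m > 0"
  shows "int m dvd kfib K n \<longleftrightarrow> kfib_rank K m dvd n"
proof -
  define a where "a = kfib_rank K m"
  have a: "a > 0" "int m dvd kfib K a"
    using kfib_rank[OF assms] by (auto simp: a_def)
  have "[kfib K n = kfib K (Suc a) ^ (n div a) * kfib K (n mod a)] (mod int m)"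
    using kfib_add_mult_cong[OF a(2), of "n mod a" "n div a"] by simp
  then have "int m dvd kfib K n \<longleftrightarrow> int m dvd kfib K (Suc a) ^ (n div a) * kfib K (n mod a)"
    by (rule cong_dvd_iff)
  also have "\<dots> \<longleftrightarrow> int m dvd kfib K (n mod a)"
    using coprime_kfib_Suc[OF a(2)]
    by (simp add: coprime_dvd_mult_right_iff coprime_commute)
  also have "\<dots> \<longleftrightarrow> n mod a = 0"
    using not_dvd_kfib_less_rank[of "n mod a" K m] a(1) by (auto simp: a_def)
  finally show ?thesis by (auto simp: a_def)
qed

text \<open>The order of \<open>s\<close> enters as an explicit \<open>k\<close>, so that each later
  case only has to inspect a few small powers. The period is \<open>k\<close> times the rank, and
  the zeros within it are the multiples of the rank.\<close>

lemma kfib_zeros_eq_order: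
  fixes K :: int and m k :: nat
  defines "s \<equiv> kfib K (Suc (kfib_rank K m))"
  assumes m: "m > 0" and k: "k > 0" "[s ^ k = 1] (mod int m)"
    and minimal: "\<And>j. 0 < j \<Longrightarrow> j < k \<Longrightarrow> \<not> [s ^ j = 1] (mod int m)"
  shows "kfib_zeros K m = k"
proof -
  define a where "a = kfib_rank K m"
  have a: "a > 0" "int m dvd kfib K a"
    using kfib_rank[OF m] by (auto simp: a_def)
  have shift: "[kfib K (n + q * a) = s ^ q * kfib K n] (mod int m)" for n q
    using kfib_add_mult_cong[OF a(2)] by (simp add: s_def a_def)
  have "kfib_period K m = k * a"
    unfolding kfib_period_def
  proof (rule Least_equality)
    have "[kfib K (n + k * a) = kfib K n] (mod int m)" for n
      using cong_trans[OF shift cong_scalar_right[OF k(2)]] by simp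
    then show "0 < k * a \<and> (\<forall>n. [kfib K (n + k * a) = kfib K n] (mod int m))"
      using a k by simp
  next
    fix t
    assume t: "0 < t \<and> (\<forall>n. [kfib K (n + t) = kfib K n] (mod int m))"
    \<comment> \<open>A period returns to the zero at index 0, so it is a multiple of the rank;
      index 1, where the term is 1, then isolates the power of \<open>s\<close>.\<close>
    from t have "[kfib K (0 + t) = kfib K 0] (mod int m)" by blast
    then have "a dvd t"
      using dvd_kfib_iff[OF m] by (simp add: a_def cong_0_iff)
    then obtain q where q: "t = q * a" by (metis dvdE mult.commute)
    from t have "[kfib K (1 + t) = kfib K 1] (mod int m)" by blast
    with shift[of 1 q] have "[s ^ q = 1] (mod int m)"
      unfolding q by (metis One_nat_def cong_sym cong_trans kfib.simps(2) mult.right_neutral)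
    moreover have "q > 0" using t q by (cases q) auto
    ultimately have "k \<le> q"
      using minimal by (meson not_le)
    then show "k * a \<le> t" using q by simp
  qed
  then have "{n. n < kfib_period K m \<and> int m dvd kfib K n} = (\<lambda>i. i * a) ` {..<k}"
    using a(1) by (auto simp: dvd_kfib_iff[OF m] a_def[symmetric] mult.commute elim: dvdE)
  moreover have "inj_on (\<lambda>i. i * a) {..<k}"
    using a(1) by (simp add: inj_on_def)
  ultimately show ?thesis
    by (simp add: kfib_zeros_def card_image)
qed

section \<open>Order of the multiplier by residue class of the rank\<close>

lemma kfib_Suc_double_rank_cong:
  assumes "prime p" and a: "kfib_rank K p = 2 * b"
  shows "[kfib K (Suc (2 * b)) = - ((-1) ^ b)] (mod int p)"
proof -
  have p: "p > 0" using assms(1) by (rule prime_gt_0_nat)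
  have b: "b > 0" using kfib_rank_pos[OF p, of K] a by simp
  have "\<not> int p dvd kfib K b"
    using not_dvd_kfib_less_rank[of b K p] a b by simp
  moreover have "int p dvd kfib K b * (2 * kfib K (Suc b) - K * kfib K b)"
    using dvd_kfib_rank[OF p, of K] by (simp only: a kfib_double)
  ultimately have "int p dvd 2 * kfib K (Suc b) - K * kfib K b"
    using assms(1) by (simp add: prime_dvd_mult_iff)
  \<comment> \<open>Expressing \<open>(-1) ^ b\<close> by Cassini's identity exposes the same factor
    that \<open>p\<close> was just shown to divide.\<close>
  moreover have "kfib K (Suc (2 * b)) - (- ((-1) ^ b))
      = kfib K (Suc b) * (2 * kfib K (Suc b) - K * kfib K b)"
    unfolding kfib_double_Suc kfib_cassini[of K b, symmetric]
    by (simp add: algebra_simps power2_eq_square)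
  ultimately show ?thesis
    by (simp only: cong_iff_dvd_diff dvd_mult)
qed

lemma not_neg_one_cong_one:
  assumes "m > 2"
  shows "\<not> [- 1 = 1] (mod int m)"
proof
  assume "[- 1 = 1] (mod int m)"
  then have "int m dvd 2"
    by (simp add: cong_iff_dvd_diff)
  then show False
    using assms zdvd_imp_le by fastforce
qed

text \<open>Here \<open>s ^ 2\<close> is \<open>-1\<close>, which differs from 1 since
  \<open>m > 2\<close>. Exponents 1 and 3 are excluded by squaring: both squares are again
  \<open>-1\<close>. Primality does not enter, so \<open>m\<close> may be composite.\<close>

lemma kfib_zeros_odd_rank:
  assumes "m > 2" "odd (kfib_rank K m)"
  shows "kfib_zeros K m = 4"
proof (rule kfib_zeros_eq_order)
  let ?s = "kfib K (Suc (kfib_rank K m))"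
  have m: "m > 0" using assms by simp
  have sq: "[?s ^ 2 = -1] (mod int m)"
    using kfib_Suc_square_cong[OF dvd_kfib_rank[OF m, of K]] assms(2) by simp
  show "[?s ^ 4 = 1] (mod int m)"
    using cong_pow[OF sq, of 2] by (simp flip: power_mult)
  fix j :: nat
  assume "0 < j" "j < 4"
  then consider "j = 1" | "j = 2" | "j = 3" by linarith
  then show "\<not> [?s ^ j = 1] (mod int m)"
  proof (cases)
    case 1
    show ?thesis
    proof
      assume "[?s ^ j = 1] (mod int m)"
      then have "[?s ^ 2 = 1] (mod int m)" using cong_pow[of ?s 1 _ 2] 1 by simp
      then show False
        using not_neg_one_cong_one[OF assms(1)] sq by (metis cong_sym cong_trans)
    qed
  next
    case 2
    then show ?thesis
      using not_neg_one_cong_one[OF assms(1)] sq by (metis cong_sym cong_trans)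
  next
    case 3
    show ?thesis
    proof
      assume "[?s ^ j = 1] (mod int m)"
      then have "[(?s ^ 3) ^ 2 = 1] (mod int m)" using cong_pow[of "?s ^ 3" 1 _ 2] 3 by simp
      moreover have "[(?s ^ 3) ^ 2 = -1] (mod int m)"
        using cong_pow[OF sq, of 3] by (simp flip: power_mult)
      ultimately show False
        using not_neg_one_cong_one[OF assms(1)] by (metis cong_sym cong_trans)
    qed
  qed
qed (use assms in auto)

text \<open>Half the rank is even, so \<open>s\<close> is \<open>-1\<close>, of order 2 because
  \<open>p\<close> is odd.\<close>

lemma kfib_zeros_rank_0_mod_4:
  assumes "prime p" "odd p" "kfib_rank K p mod 4 = 0"
  shows "kfib_zeros K p = 2"
proof (rule kfib_zeros_eq_order)
  let ?s = "kfib K (Suc (kfib_rank K p))"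
  define b where "b = kfib_rank K p div 2"
  have b: "kfib_rank K p = 2 * b" "even b"
    using assms(3) unfolding b_def by presburger+
  have s: "[?s = -1] (mod int p)"
    using kfib_Suc_double_rank_cong[OF assms(1) b(1)] b by simp
  show "[?s ^ 2 = 1] (mod int p)"
    using cong_pow[OF s, of 2] by simp
  fix j :: nat
  assume "0 < j" "j < 2"
  then have "j = 1" by simp
  moreover have "p > 2"
    using assms prime_gt_1_nat[of p] by (cases "p = 2") auto
  ultimately show "\<not> [?s ^ j = 1] (mod int p)"
    using not_neg_one_cong_one[of p] s by (metis cong_sym cong_trans power_one_right)
qed (use assms prime_gt_0_nat in auto)

text \<open>Half the rank is odd, so \<open>s\<close> is already 1 and the minimality condition is
  vacuous.\<close>

lemma kfib_zeros_rank_2_mod_4: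
  assumes "prime p" "kfib_rank K p mod 4 = 2"
  shows "kfib_zeros K p = 1"
proof (rule kfib_zeros_eq_order)
  define b where "b = kfib_rank K p div 2"
  have b: "kfib_rank K p = 2 * b" "odd b"
    using assms(2) unfolding b_def by presburger+
  show "[kfib K (Suc (kfib_rank K p)) ^ 1 = 1] (mod int p)"
    using kfib_Suc_double_rank_cong[OF assms(1) b(1)] b by simp
qed (use assms prime_gt_0_nat in auto)

theorem theorem4p23:
  fixes K :: int and p :: nat
  assumes "prime p" and "odd p"
  shows "(kfib_zeros K p = 4 \<longleftrightarrow>
            [int (kfib_rank K p) = 1] (mod 4) \<or> [int (kfib_rank K p) = - 1] (mod 4)) \<and>
         (kfib_zeros K p = 2 \<longleftrightarrow> [int (kfib_rank K p) = 0] (mod 4)) \<and>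
         (kfib_zeros K p = 1 \<longleftrightarrow> [int (kfib_rank K p) = 2] (mod 4))"
proof -
  let ?a = "kfib_rank K p"
  have p: "p > 2"
    using assms prime_gt_1_nat[of p] by (cases "p = 2") auto
  \<comment> \<open>The cases are exhaustive and give the distinct counts 4, 2 and 1, so each
    implication is also an equivalence.\<close>
  have "odd ?a \<or> ?a mod 4 = 0 \<or> ?a mod 4 = 2" by presburger
  then show ?thesis
  proof (elim disjE)
    assume 1: "odd ?a"
    then have "int ?a mod 4 = 1 \<or> int ?a mod 4 = 3" by presburger
    with kfib_zeros_odd_rank[OF p 1] show ?thesis by (auto simp: cong_def)
  next
    assume 2: "?a mod 4 = 0"
    then have "int ?a mod 4 = 0" by presburger
    with kfib_zeros_rank_0_mod_4[OF assms 2] show ?thesis by (auto simp: cong_def)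
  next
    assume 3: "?a mod 4 = 2"
    then have "int ?a mod 4 = 2" by presburger
    with kfib_zeros_rank_2_mod_4[OF assms(1) 3] show ?thesis by (auto simp: cong_def)
  qed
qed

end
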